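(* There is a constant $c>0$ such that if every entry of $x\in\{0,1\}^n$ is drawn independently according to $\mathrm{Ber}(\eta)$ with $\eta\le c/\sqrt{n\log n}$, then $\mathrm{poly}(n)$ traces of $x$ from the deletion channel with deletion probability $1/2$ suffice to recover $x$ with high probability.
   Context: The deletion channel with deletion probability $1/2$ deletes each coordinate of $x$ independently with probability $1/2$ and outputs the subsequence of surviving coordinates (deletion locations unknown); each output is a trace. "With high probability" means with probability at least $1-o(1)$ as $n\to\infty$, over the randomness of $x$ and of the channel. *)

theory Defs
  imports "HOL-Probability.Probability" "HOL-Library.Landau_Symbols"
begin

text \<open>Binary strings are Boolean lists, with True playing the role of 1.\<close>

text \<open>Entry \<open>i\<close> of the i.i.d. list \<open>ds\<close> says whether coordinate \<open>i\<close> is deleted; only the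
  surviving subsequence is output, not \<open>ds\<close>.\<close>

definition deletion_channel :: "real \<Rightarrow> 'a list \<Rightarrow> 'a list pmf" where
  "deletion_channel q x =
     map_pmf (\<lambda>ds. nths x {i. \<not> ds ! i}) (replicate_pmf (length x) (bernoulli_pmf q))"

definition random_string :: "nat \<Rightarrow> real \<Rightarrow> bool list pmf" where
  "random_string n \<eta> = replicate_pmf n (bernoulli_pmf \<eta>)"

text \<open>Joint law of the random source string and of \<open>t\<close> traces of it, which are independent
  conditionally on the source.\<close>

definition source_and_traces :: "real \<Rightarrow> nat \<Rightarrow> real \<Rightarrow> nat \<Rightarrow> (bool list \<times> bool list list) pmf" where
  "source_and_traces q n \<eta> t =
     bind_pmf (random_string n \<eta>) (\<lambda>x.
       map_pmf (\<lambda>ys. (x, ys)) (replicate_pmf t (deletion_channel q x)))"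

end

theory Submission
  imports Defs "HOL-Real_Asymp.Real_Asymp"
begin

text \<open>
  With \<open>l\<close> of order \<open>sqrt (n * ln n)\<close> and \<open>\<eta> * l \<le> 1/16\<close>, a union bound shows that with high
  probability the source contains no chain of more than \<open>k = log\<^sub>2 n\<close> ones with consecutive
  distances at most \<open>l\<close>. So its ones split into clusters of at most \<open>k\<close> ones, separated by more
  than \<open>l\<close>. By Hoeffding's inequality the coordinate at position \<open>i\<close> lands within
  \<open>\<delta> \<approx> l / 12\<close> of position \<open>i / 2\<close> of the trace, simultaneously for all \<open>i\<close>, except with
  probability \<open>O(n\<^bsup>-7\<^esup>)\<close>; hence a window of the trace isolates a single cluster.

  Let \<open>x\<close> and \<open>x'\<close> be two such strings. If a window shows at most \<open>m\<close> ones of \<open>x\<close> but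
  contains more than \<open>m\<close> ones of \<open>x'\<close>, the event that more than \<open>m\<close> ones appear in it has
  probability almost \<open>0\<close> for \<open>x\<close> and at least about \<open>2\<^bsup>-m-1\<^esup>\<close> for \<open>x'\<close>. If the counts agree
  on every cluster, then on the event that all \<open>m\<close> ones of a cluster survive (probability
  \<open>2\<^bsup>-m\<^esup> \<ge> 1/n\<close>) the mean position of the \<open>j\<close>-th one reveals its position in the source.
  Either way some \<open>[0,1]\<close>-valued statistic of one trace has means under \<open>x\<close> and \<open>x'\<close> that differ by
  \<open>1 / (4 * n\<^sup>2)\<close>. Since there are at most \<open>4\<^sup>n\<close> pairs of strings, \<open>n\<^sup>6\<close> traces estimate
  all these pairwise statistics accurately enough at once.
\<close>

section \<open>Concentration for independent samples\<close>

text \<open>The exponential moment factorises over the samples, and Hoeffding's lemma bounds each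
  factor by \<open>exp (l\<^sup>2 / 8)\<close>, since \<open>f\<close> takes values in an interval
  of length 1.\<close>

lemma nn_integral_exp_replicate_pmf:
  fixes f :: "'a \<Rightarrow> real"
  assumes f: "\<And>y. f y \<in> {0..1}" and l: "l > 0"
  shows "(\<integral>\<^sup>+ys. exp (l * (\<Sum>y\<leftarrow>ys. f y - measure_pmf.expectation M f)) \<partial>replicate_pmf t M)
           \<le> ennreal (exp (real t * l\<^sup>2 / 8))"
proof (induction t)
  case 0
  show ?case by simp
next
  case (Suc t)
  interpret interval_bounded_random_variable "measure_pmf M" f 0 1
    by unfold_locales (use f in auto)
  have "(\<integral>\<^sup>+ys. exp (l * (\<Sum>y\<leftarrow>ys. f y - measure_pmf.expectation M f)) \<partial>replicate_pmf (Suc t) M)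
     = (\<integral>\<^sup>+y. (\<integral>\<^sup>+ys. ennreal (exp (l * (f y - measure_pmf.expectation M f))) *
          exp (l * (\<Sum>y\<leftarrow>ys. f y - measure_pmf.expectation M f)) \<partial>replicate_pmf t M) \<partial>M)"
    by (simp add: ring_distribs exp_add flip: ennreal_mult)
  also have "\<dots> \<le> (\<integral>\<^sup>+y. ennreal (exp (l * (f y - measure_pmf.expectation M f))) *
          ennreal (exp (real t * l\<^sup>2 / 8)) \<partial>M)"
    by (subst nn_integral_cmult, simp) (intro nn_integral_mono mult_left_mono Suc.IH, simp)
  also have "\<dots> = (\<integral>\<^sup>+y. ennreal (exp (l * (f y - measure_pmf.expectation M f))) \<partial>M) *
          ennreal (exp (real t * l\<^sup>2 / 8))"
    by (subst nn_integral_multc) simp_all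
  also have "\<dots> \<le> ennreal (exp (l\<^sup>2 * (1 - 0)\<^sup>2 / 8)) * ennreal (exp (real t * l\<^sup>2 / 8))"
    by (intro mult_right_mono Hoeffdings_lemma_nn_integral l) simp
  also have "\<dots> = ennreal (exp (real (Suc t) * l\<^sup>2 / 8))"
    by (simp add: algebra_simps add_divide_distrib flip: ennreal_mult exp_add)
  finally show ?case .
qed

lemma replicate_pmf_Hoeffding_upper:
  fixes f :: "'a \<Rightarrow> real"
  assumes f: "\<And>y. f y \<in> {0..1}" and s: "s \<ge> 0"
  shows "measure_pmf.prob (replicate_pmf t M)
           {ys. (\<Sum>y\<leftarrow>ys. f y - measure_pmf.expectation M f) \<ge> s} \<le> exp (- 2 * s\<^sup>2 / real t)"
proof (cases "s = 0 \<or> t = 0")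
  case True
  \<comment> \<open>Since division by 0 yields 0, the exponent vanishes in both degenerate cases and
    the bound is 1.\<close>
  thus ?thesis by (auto intro: order_trans[OF measure_pmf.prob_le_1])
next
  case False
  hence st: "s > 0" "t > 0" using s by auto
  define X where "X = (\<lambda>ys. \<Sum>y\<leftarrow>ys. f y - measure_pmf.expectation M f)"
  \<comment> \<open>This value minimises the Chernoff exponent
    \<open>t * l\<^sup>2 / 8 - l * s\<close>.\<close>
  define l where "l = 4 * s / t"
  have l: "l > 0" using st by (simp add: l_def)
  have "emeasure (replicate_pmf t M) {ys. X ys \<ge> s}
      \<le> ennreal (exp (- (l * s))) * (\<integral>\<^sup>+ys. exp (l * X ys) * indicator UNIV ys \<partial>replicate_pmf t M)"
  proof -
    have "{ys. X ys \<ge> s} = {ys \<in> UNIV. 1 \<le> ennreal (exp (- (l * s))) * ennreal (exp (l * X ys))}"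
      using l by (auto simp flip: ennreal_mult exp_add simp: ennreal_1[symmetric] simp del: ennreal_1)
    thus ?thesis
      using nn_integral_Markov_inequality[of "\<lambda>ys. ennreal (exp (l * X ys))" UNIV
          "measure_pmf (replicate_pmf t M)" "ennreal (exp (- (l * s)))"] by simp
  qed
  also have "\<dots> \<le> ennreal (exp (- (l * s))) * ennreal (exp (real t * l\<^sup>2 / 8))"
    using nn_integral_exp_replicate_pmf[OF f l, where M = M and t = t] by (auto intro!: mult_left_mono simp: X_def)
  also have "\<dots> = ennreal (exp (- 2 * s\<^sup>2 / real t))"
    using st by (simp add: l_def power2_eq_square field_simps flip: ennreal_mult exp_add)
  finally show ?thesis
    by (simp add: measure_pmf.emeasure_eq_measure X_def)
qed

text \<open>The lower tail of \<open>f\<close> is the upper tail of \<open>1 - f\<close>.\<close>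

lemma replicate_pmf_Hoeffding:
  fixes f :: "'a \<Rightarrow> real"
  assumes f: "\<And>y. f y \<in> {0..1}" and s: "s \<ge> 0"
  shows "measure_pmf.prob (replicate_pmf t M)
           {ys. \<bar>(\<Sum>y\<leftarrow>ys. f y) - real t * measure_pmf.expectation M f\<bar> \<ge> s} \<le> 2 * exp (- 2 * s\<^sup>2 / real t)"
proof -
  let ?P = "measure_pmf.prob (replicate_pmf t M)" and ?mu = "measure_pmf.expectation M f"
  have int: "integrable M f"
    by (rule measure_pmf.integrable_const_bound[where B = 1]) (use f in auto)
  have sub: "(\<Sum>y\<leftarrow>ys. f y - ?mu) = (\<Sum>y\<leftarrow>ys. f y) - real (length ys) * ?mu" for ys
    by (induction ys) (auto simp: algebra_simps)
  have sub': "(\<Sum>y\<leftarrow>ys. (1 - f y) - measure_pmf.expectation M (\<lambda>y. 1 - f y)) = real (length ys) * ?mu - (\<Sum>y\<leftarrow>ys. f y)" for ys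
    using int by (induction ys) (auto simp: algebra_simps)
  have f': "1 - f y \<in> {0..1}" for y using f[of y] by auto
  have "?P {ys. \<bar>(\<Sum>y\<leftarrow>ys. f y) - real t * ?mu\<bar> \<ge> s}
     \<le> ?P ({ys. (\<Sum>y\<leftarrow>ys. f y - ?mu) \<ge> s} \<union> {ys. (\<Sum>y\<leftarrow>ys. (1 - f y) - measure_pmf.expectation M (\<lambda>y. 1 - f y)) \<ge> s})"
    \<comment> \<open>The rewritten sums involve \<open>length ys\<close>, which equals
      \<open>t\<close> only on the support; hence the almost-sure form of monotonicity.\<close>
    unfolding sub sub'
    by (rule measure_pmf.finite_measure_mono_AE) (auto simp: AE_measure_pmf_iff set_replicate_pmf)
  also have "\<dots> \<le> exp (- 2 * s\<^sup>2 / real t) + exp (- 2 * s\<^sup>2 / real t)"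
    by (intro order_trans[OF measure_Un_le] add_mono
          replicate_pmf_Hoeffding_upper f f' s) auto
  finally show ?thesis by simp
qed

text \<open>Independence of the coordinates. The induction splits off the head, which must lie in
  \<open>A\<close> or is free (the set \<open>B\<close>), and shifts the other indices down by
  one.\<close>

lemma prob_replicate_pmf_all:
  assumes "S \<subseteq> {..<n}"
  shows "measure_pmf.prob (replicate_pmf n M) {xs. \<forall>i\<in>S. xs ! i \<in> A} = measure_pmf.prob M A ^ card S"
  using assms
proof (induction n arbitrary: S)
  case 0
  thus ?case by simp
next
  case (Suc n)
  define S' where "S' = {i. Suc i \<in> S}"
  have S': "S' \<subseteq> {..<n}" using Suc.prems by (auto simp: S'_def)
  have fin: "finite S'" using S' finite_subset by blast
  have S_eq: "S = (if 0 \<in> S then {0} else {}) \<union> Suc ` S'"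
    unfolding S'_def by (auto simp: image_iff split: if_splits) (metis not0_implies_Suc)+
  have card_S: "card S = (if 0 \<in> S then 1 else 0) + card S'"
    by (subst S_eq) (use fin in \<open>auto simp: card_image card_insert_if\<close>)
  define B where "B = (if 0 \<in> S then A else UNIV)"
  have iff: "(\<forall>i\<in>S. (x # xs) ! i \<in> A) \<longleftrightarrow> x \<in> B \<and> (\<forall>i\<in>S'. xs ! i \<in> A)" for x xs
    by (subst S_eq) (auto simp: B_def)
  have "emeasure (replicate_pmf (Suc n) M) {xs. \<forall>i\<in>S. xs ! i \<in> A}
     = (\<integral>\<^sup>+x. indicator B x * emeasure (replicate_pmf n M) {xs. \<forall>i\<in>S'. xs ! i \<in> A} \<partial>M)"
    unfolding replicate_pmf.simps emeasure_bind_pmf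
  proof (intro nn_integral_cong)
    fix x
    have "(\<integral>\<^sup>+ xs. emeasure (return_pmf (x # xs)) {xs. \<forall>i\<in>S. xs ! i \<in> A} \<partial>replicate_pmf n M)
      = (\<integral>\<^sup>+ xs. indicator B x * indicator {xs. \<forall>i\<in>S'. xs ! i \<in> A} xs \<partial>replicate_pmf n M)"
      by (intro nn_integral_cong) (auto simp: iff emeasure_return_pmf indicator_def)
    also have "\<dots> = indicator B x * emeasure (replicate_pmf n M) {xs. \<forall>i\<in>S'. xs ! i \<in> A}"
      by (subst nn_integral_cmult) auto
    finally show "(\<integral>\<^sup>+ xs. emeasure (return_pmf (x # xs)) {xs. \<forall>i\<in>S. xs ! i \<in> A} \<partial>replicate_pmf n M) =
           indicator B x * emeasure (replicate_pmf n M) {xs. \<forall>i\<in>S'. xs ! i \<in> A}" .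
  qed
  also have "\<dots> = emeasure M B * emeasure (replicate_pmf n M) {xs. \<forall>i\<in>S'. xs ! i \<in> A}"
    by (subst nn_integral_multc) auto
  finally have "measure_pmf.prob (replicate_pmf (Suc n) M) {xs. \<forall>i\<in>S. xs ! i \<in> A}
     = measure_pmf.prob M B * measure_pmf.prob M A ^ card S'"
    using Suc.IH[OF S'] by (simp add: measure_pmf.emeasure_eq_measure flip: ennreal_mult)
  also have "measure_pmf.prob M B = measure_pmf.prob M A ^ (if 0 \<in> S then 1 else 0)"
    by (simp add: B_def)
  finally show ?case by (simp add: card_S)
qed

lemma map_take_replicate_pmf:
  assumes "m \<le> n"
  shows "map_pmf (take m) (replicate_pmf n M) = replicate_pmf m M"
proof -
  have "map_pmf (take m) (replicate_pmf (m + (n - m)) M)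
      = replicate_pmf m M \<bind> (\<lambda>xs. replicate_pmf (n - m) M \<bind> (\<lambda>ys. return_pmf xs))"
    unfolding replicate_pmf_distrib map_bind_pmf map_return_pmf
    by (intro bind_pmf_cong refl) (auto simp: set_replicate_pmf)
  thus ?thesis using assms by (simp add: bind_return_pmf')
qed

section \<open>Reconstruction from pairwise tests\<close>

text \<open>By Hoeffding and a union bound over ordered pairs, all empirical means are within
  \<epsilon>/2 of the true ones. Then the true source passes each of its tests, while any other
  candidate fails its test against the true source.\<close>

lemma pairwise_tests_imp_reconstruction:
  fixes P :: "'a \<Rightarrow> 'b pmf" and \<epsilon> :: real
  assumes G: "finite G" and \<epsilon>: "\<epsilon> > 0"
    and tests: "\<And>x y. x \<in> G \<Longrightarrow> y \<in> G \<Longrightarrow> x \<noteq> y \<Longrightarrow>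
      \<exists>f :: 'b \<Rightarrow> real. (\<forall>z. f z \<in> {0..1}) \<and>
        \<bar>measure_pmf.expectation (P x) f - measure_pmf.expectation (P y) f\<bar> \<ge> \<epsilon>"
  shows "\<exists>R. \<forall>x\<in>G. measure_pmf.prob (replicate_pmf t (P x)) {ys. R ys \<noteq> x}
           \<le> 2 * (card G)\<^sup>2 * exp (- real t * \<epsilon>\<^sup>2 / 2)"
proof (cases "t = 0")
  case True
  \<comment> \<open>Without traces the claimed bound is at least 1, so any decoder will do.\<close>
  have "1 \<le> 2 * (real (card G))\<^sup>2" if "x \<in> G" for x
  proof -
    have "1 \<le> card G" using that G by (metis One_nat_def Suc_leI card_gt_0_iff empty_iff)
    hence "1 ^ 2 \<le> (real (card G)) ^ 2" by (intro power_mono) auto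
    thus ?thesis by simp
  qed
  thus ?thesis using True by (auto simp: indicator_def intro!: exI[of _ undefined])
next
  case False
  hence t: "real t > 0" by simp
  let ?E = "\<lambda>x f. measure_pmf.expectation (P x) f"
  obtain F :: "'a \<Rightarrow> 'a \<Rightarrow> 'b \<Rightarrow> real" where
    F: "\<And>x y z. x \<in> G \<Longrightarrow> y \<in> G \<Longrightarrow> x \<noteq> y \<Longrightarrow> F x y z \<in> {0..1}" and
    F_gap: "\<And>x y. x \<in> G \<Longrightarrow> y \<in> G \<Longrightarrow> x \<noteq> y \<Longrightarrow> \<bar>?E x (F x y) - ?E y (F x y)\<bar> \<ge> \<epsilon>"
    using tests by metis
  define close where
    "close = (\<lambda>ys x p. \<bar>(\<Sum>y\<leftarrow>ys. F (fst p) (snd p) y) - real t * ?E x (F (fst p) (snd p))\<bar> < real t * \<epsilon> / 2)"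
  define pairs where "pairs = {p \<in> G \<times> G. fst p \<noteq> snd p}"
  have pairs: "finite pairs" "pairs \<subseteq> G \<times> G" using G by (auto simp: pairs_def)
  have card_pairs: "real (card pairs) \<le> (card G)\<^sup>2"
    using card_mono[OF _ pairs(2)] G
    by (simp add: card_cartesian_product power2_eq_square flip: of_nat_mult)
  define R where "R = (\<lambda>ys. SOME z. z \<in> G \<and> (\<forall>w\<in>G. w \<noteq> z \<longrightarrow> close ys z (z, w)))"
  show ?thesis
  proof (intro exI[of _ R] ballI)
    fix x assume x: "x \<in> G"
    have "R ys = x" if ys: "\<forall>p\<in>pairs. close ys x p" for ys
      unfolding R_def
    proof (rule some_equality)
      show "x \<in> G \<and> (\<forall>w\<in>G. w \<noteq> x \<longrightarrow> close ys x (x, w))"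
        using x ys by (auto simp: pairs_def)
    next
      fix z assume z: "z \<in> G \<and> (\<forall>w\<in>G. w \<noteq> z \<longrightarrow> close ys z (z, w))"
      show "z = x"
      proof (rule ccontr)
        assume ne: "z \<noteq> x"
        \<comment> \<open>One empirical mean would be within \<epsilon>/2 of two expectations that
          are at least \<epsilon> apart.\<close>
        hence "close ys z (z, x)" "close ys x (z, x)" using z x ys by (auto simp: pairs_def)
        hence "\<bar>real t * ?E z (F z x) - real t * ?E x (F z x)\<bar> < real t * \<epsilon>"
          unfolding close_def fst_conv snd_conv by linarith
        moreover have "\<bar>real t * ?E z (F z x) - real t * ?E x (F z x)\<bar>
            = real t * \<bar>?E z (F z x) - ?E x (F z x)\<bar>"
          by (simp add: abs_mult flip: right_diff_distrib)
        moreover have "real t * \<epsilon> \<le> real t * \<bar>?E z (F z x) - ?E x (F z x)\<bar>"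
          using F_gap[of z x] z x ne by (intro mult_left_mono) auto
        ultimately show False by linarith
      qed
    qed
    hence "measure_pmf.prob (replicate_pmf t (P x)) {ys. R ys \<noteq> x}
        \<le> measure_pmf.prob (replicate_pmf t (P x)) (\<Union>p\<in>pairs. {ys. \<not> close ys x p})"
      by (intro measure_pmf.finite_measure_mono) auto
    also have "\<dots> \<le> (\<Sum>p\<in>pairs. measure_pmf.prob (replicate_pmf t (P x)) {ys. \<not> close ys x p})"
      by (rule measure_pmf.finite_measure_subadditive_finite) (use pairs in auto)
    also have "\<dots> \<le> (\<Sum>p\<in>pairs. 2 * exp (- real t * \<epsilon>\<^sup>2 / 2))"
    proof (rule sum_mono)
      fix p assume "p \<in> pairs"
      hence "F (fst p) (snd p) z \<in> {0..1}" for z using F by (auto simp: pairs_def)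
      hence "measure_pmf.prob (replicate_pmf t (P x)) {ys. \<not> close ys x p}
          \<le> 2 * exp (- 2 * (real t * \<epsilon> / 2)\<^sup>2 / real t)"
        unfolding close_def not_less
        by (rule replicate_pmf_Hoeffding) (use \<epsilon> in auto)
      also have "- 2 * (real t * \<epsilon> / 2)\<^sup>2 / real t = - real t * \<epsilon>\<^sup>2 / 2"
        using t by (simp add: power2_eq_square)
      finally show "measure_pmf.prob (replicate_pmf t (P x)) {ys. \<not> close ys x p}
          \<le> 2 * exp (- real t * \<epsilon>\<^sup>2 / 2)" .
    qed
    also have "\<dots> \<le> 2 * (card G)\<^sup>2 * exp (- real t * \<epsilon>\<^sup>2 / 2)"
      using card_pairs by simp
    finally show "measure_pmf.prob (replicate_pmf t (P x)) {ys. R ys \<noteq> x}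
           \<le> 2 * (card G)\<^sup>2 * exp (- real t * \<epsilon>\<^sup>2 / 2)" .
  qed
qed

text \<open>The failure probability given the source is averaged: it is at most \<delta> on
  \<open>G\<close> and at most 1 elsewhere.\<close>

lemma prob_source_and_traces_ge:
  assumes \<delta>: "\<delta> \<ge> 0"
    and R: "\<And>x. x \<in> G \<Longrightarrow> measure_pmf.prob (replicate_pmf t (deletion_channel q x)) {ys. R ys \<noteq> x} \<le> \<delta>"
  shows "measure_pmf.prob (source_and_traces q n \<eta> t) {(x, ys). R ys = x}
           \<ge> 1 - measure_pmf.prob (random_string n \<eta>) (- G) - \<delta>"
proof -
  let ?N = "\<lambda>x. replicate_pmf t (deletion_channel q x)"
  have "emeasure (source_and_traces q n \<eta> t) {(x, ys). R ys \<noteq> x}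
      = (\<integral>\<^sup>+x. emeasure (?N x) {ys. R ys \<noteq> x} \<partial>random_string n \<eta>)"
    unfolding source_and_traces_def emeasure_bind_pmf by (simp add: vimage_def)
  also have "\<dots> \<le> (\<integral>\<^sup>+x. indicator (- G) x + ennreal \<delta> \<partial>random_string n \<eta>)"
  proof (rule nn_integral_mono)
    fix x
    show "emeasure (?N x) {ys. R ys \<noteq> x} \<le> indicator (- G) x + ennreal \<delta>"
    proof (cases "x \<in> G")
      case True
      thus ?thesis using R by (simp add: measure_pmf.emeasure_eq_measure ennreal_leI)
    next
      case False
      have "emeasure (?N x) {ys. R ys \<noteq> x} \<le> 1"
        by (rule measure_pmf.emeasure_le_1)
      thus ?thesis using False by (simp add: add_increasing2)
    qed
  qed
  also have "\<dots> = emeasure (random_string n \<eta>) (- G) + ennreal \<delta>"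
    by (subst nn_integral_add) auto
  finally have "measure_pmf.prob (source_and_traces q n \<eta> t) {(x, ys). R ys \<noteq> x}
      \<le> measure_pmf.prob (random_string n \<eta>) (- G) + \<delta>"
    using \<delta> by (simp add: measure_pmf.emeasure_eq_measure flip: ennreal_plus)
  moreover have "{(x, ys). R ys = x} = UNIV - {(x, ys). R ys \<noteq> x}" by auto
  ultimately show ?thesis
    using measure_pmf.prob_compl[of "{(x, ys). R ys \<noteq> x}" "source_and_traces q n \<eta> t"] by simp
qed

section \<open>Clusters of ones\<close>

definition ones :: "bool list \<Rightarrow> nat set" where
  "ones x = {i. i < length x \<and> x ! i}"

lemma finite_ones [simp, intro]: "finite (ones x)"
  by (simp add: ones_def)

lemma ones_inject:
  assumes "length x = length y" "ones x = ones y"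
  shows "x = y"
proof (rule nth_equalityI)
  fix i assume "i < length x"
  thus "x ! i = y ! i" using assms by (auto simp: ones_def set_eq_iff)
qed fact

text \<open>The parameter \<open>k\<close> counts steps, so such a chain visits \<open>k + 1\<close>
  elements; this is why excluding chains leaves clusters of at most \<open>k\<close>
  elements.\<close>

primrec chain :: "nat \<Rightarrow> nat set \<Rightarrow> nat \<Rightarrow> nat \<Rightarrow> bool" where
  "chain l A 0 i \<longleftrightarrow> i \<in> A"
| "chain l A (Suc k) i \<longleftrightarrow> i \<in> A \<and> (\<exists>g\<in>{1..l}. chain l A k (i + g))"

lemma chain_antimono: "chain l A k i \<Longrightarrow> j \<le> k \<Longrightarrow> chain l A j i"
proof (induction k arbitrary: i j)
  case (Suc k)
  thus ?case by (cases j) auto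
qed simp

definition chainless :: "nat \<Rightarrow> nat \<Rightarrow> nat \<Rightarrow> bool list set" where
  "chainless n l k = {x. length x = n \<and> (\<forall>i. \<not> chain l (ones x) k i)}"

text \<open>Always moving to the next element visits all of \<open>A \<inter> {a..b}\<close>. The
  link given at \<open>a\<close> may skip elements, but then the next element is nearer
  still.\<close>

lemma chain_cluster:
  assumes A: "finite A" and a: "a \<in> A" and b: "a \<le> b"
    and links: "\<And>i. i \<in> A \<Longrightarrow> a \<le> i \<Longrightarrow> i < b \<Longrightarrow> \<exists>g\<in>{1..l}. i + g \<in> A \<and> i + g \<le> b"
  shows "chain l A (card (A \<inter> {a..b}) - 1) a"
  using a b links
proof (induction "b - a" arbitrary: a rule: less_induct)
  case less
  show ?case
  proof (cases "A \<inter> {a<..b} = {}")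
    case True
    have "A \<inter> {a..b} = {a} \<union> (A \<inter> {a<..b})" using less.prems by auto
    thus ?thesis using True less.prems by simp
  next
    case False
    define a' where "a' = Min (A \<inter> {a<..b})"
    have a': "a' \<in> A \<inter> {a<..b}" using Min_in[OF _ False] A by (simp add: a'_def)
    have min: "a' \<le> i" if "i \<in> A \<inter> {a<..b}" for i
      using that A by (simp add: a'_def)
    have "A \<inter> {a..b} = insert a (A \<inter> {a'..b})"
      using a' min less.prems by force
    hence card: "card (A \<inter> {a..b}) = Suc (card (A \<inter> {a'..b}))"
      using a' A by simp
    have "card (A \<inter> {a'..b}) > 0" using a' A by (auto simp: card_gt_0_iff)
    hence card': "card (A \<inter> {a..b}) - 1 = Suc (card (A \<inter> {a'..b}) - 1)" using card by simp
    obtain g where g: "g \<in> {1..l}" "a + g \<in> A" "a + g \<le> b"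
      using less.prems a' by (metis IntD2 greaterThanAtMost_iff le_refl less_le_trans)
    have "a' \<le> a + g" using min g by auto
    moreover have "chain l A (card (A \<inter> {a'..b}) - 1) a'"
      by (rule less.hyps) (use a' less.prems in auto)
    ultimately show ?thesis
      unfolding card' using less.prems(1) a' g by (auto intro!: bexI[of _ "a' - a"])
  qed
qed

text \<open>The cluster extends from \<open>p\<close> to the nearest gap longer than
  \<open>l\<close> on either side. It has no such gap inside, so a chain runs through all of it, and
  its size is bounded by the absence of chains with \<open>k\<close> steps.\<close>

lemma cluster_exists:
  assumes A: "finite A" and p: "p \<in> A" and no_chain: "\<And>i. \<not> chain l A k i"
  obtains a b where "a \<in> A" "b \<in> A" "a \<le> p" "p \<le> b" "card (A \<inter> {a..b}) \<le> k"
    "\<And>i. i \<in> A \<Longrightarrow> i < a \<Longrightarrow> i + l < a" "\<And>i. i \<in> A \<Longrightarrow> b < i \<Longrightarrow> b + l < i"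
proof -
  define Left where "Left = {a\<in>A. a \<le> p \<and> (\<forall>i\<in>A. i < a \<longrightarrow> i + l < a)}"
  define Right where "Right = {b\<in>A. p \<le> b \<and> (\<forall>i\<in>A. b < i \<longrightarrow> b + l < i)}"
  have "Min A \<in> A" "Max A \<in> A" using A p by (auto intro!: Min_in Max_in)
  hence "Min A \<in> Left" "Max A \<in> Right"
    using A p by (auto simp: Left_def Right_def leD)
  hence ne: "Left \<noteq> {}" "Right \<noteq> {}" by auto
  have fin: "finite Left" "finite Right" using A by (auto simp: Left_def Right_def)
  define a where "a = Max Left"
  define b where "b = Min Right"
  have a: "a \<in> Left" and b: "b \<in> Right"
    using Max_in[OF fin(1) ne(1)] Min_in[OF fin(2) ne(2)] by (simp_all add: a_def b_def)
  have "chain l A (card (A \<inter> {a..b}) - 1) a"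
  proof (rule chain_cluster[OF A])
    fix i assume i: "i \<in> A" "a \<le> i" "i < b"
    show "\<exists>g\<in>{1..l}. i + g \<in> A \<and> i + g \<le> b"
    proof (cases "p \<le> i")
      case True
      \<comment> \<open>By minimality of \<open>b\<close>, no long gap follows \<open>i\<close>; the
        element found cannot lie beyond \<open>b\<close>, after which there is a long gap.\<close>
      have "i \<notin> Right" using Min_le[OF fin(2), of i] i by (auto simp: b_def)
      then obtain j where j: "j \<in> A" "i < j" "j \<le> i + l"
        using i True by (auto simp: Right_def not_less)
      have "j \<le> b"
      proof (rule ccontr)
        assume "\<not> j \<le> b"
        hence "b + l < j" using b j by (auto simp: Right_def)
        thus False using j i by linarith
      qed
      thus ?thesis using j by (intro bexI[of _ "j - i"]) auto
    next
      case False
      \<comment> \<open>To the left of \<open>p\<close> only gaps before an element are controlled.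
        So the successor \<open>j\<close> of \<open>i\<close> is considered: it is not in
        \<open>Left\<close>, and its near predecessor is at most \<open>i\<close>.\<close>
      define j where "j = Min (A \<inter> {i<..p})"
      have "A \<inter> {i<..p} \<noteq> {}" using False p by auto
      hence j: "j \<in> A \<inter> {i<..p}" using A unfolding j_def by (intro Min_in) auto
      have "j \<notin> Left" using Max_ge[OF fin(1), of j] j i by (auto simp: a_def)
      then obtain i' where i': "i' \<in> A" "i' < j" "j \<le> i' + l"
        using j by (auto simp: Left_def not_less)
      have "i' \<le> i"
      proof (rule ccontr)
        assume "\<not> i' \<le> i"
        hence "j \<le> i'" using i' j A unfolding j_def by (intro Min_le) auto
        thus False using i' by simp
      qed
      moreover have "j \<le> b" using j b by (auto simp: Right_def)
      ultimately show ?thesis using j i' by (intro bexI[of _ "j - i"]) auto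
    qed
  qed (use a b in \<open>auto simp: Left_def Right_def\<close>)
  hence "card (A \<inter> {a..b}) \<le> k"
    using no_chain chain_antimono[of l A "card (A \<inter> {a..b}) - 1" a k] by fastforce
  thus ?thesis using a b by (intro that[of a b]) (auto simp: Left_def Right_def)
qed

text \<open>The set \<open>S\<close> collects the ones already visited, so that no independence between the steps of
  a chain has to be exploited in the induction.\<close>

lemma prob_chain_le:
  assumes \<eta>: "0 \<le> \<eta>" "\<eta> \<le> 1" and S: "S \<subseteq> {..<i}"
  shows "measure_pmf.prob (random_string n \<eta>) {x. S \<subseteq> ones x \<and> chain l (ones x) k i}
           \<le> \<eta> ^ (card S + 1) * (\<eta> * l) ^ k"
  using S
proof (induction k arbitrary: S i)
  case 0
  have fin: "finite S" "i \<notin> S" using 0 finite_subset by auto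
  show ?case
  proof (cases "insert i S \<subseteq> {..<n}")
    case True
    have "measure_pmf.prob (random_string n \<eta>) {x. S \<subseteq> ones x \<and> chain l (ones x) 0 i}
        \<le> measure_pmf.prob (random_string n \<eta>) {x. \<forall>j\<in>insert i S. x ! j \<in> {True}}"
      by (intro measure_pmf.finite_measure_mono) (auto simp: ones_def)
    also have "\<dots> = \<eta> ^ card (insert i S)"
      unfolding random_string_def prob_replicate_pmf_all[OF True]
      using \<eta> by (simp add: measure_pmf_single)
    finally show ?thesis using fin by simp
  next
    case False
    have "measure_pmf.prob (random_string n \<eta>) {x. S \<subseteq> ones x \<and> chain l (ones x) 0 i} = 0"
      using False by (auto simp: measure_pmf_zero_iff random_string_def set_replicate_pmf ones_def)
    thus ?thesis using \<eta> by simp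
  qed
next
  case (Suc k)
  let ?P = "measure_pmf.prob (random_string n \<eta>)"
  have fin: "finite S" "i \<notin> S" using Suc.prems finite_subset by auto
  \<comment> \<open>The next one is at distance \<open>g\<close> for one of \<open>l\<close> values;
    \<open>i\<close> joins the visited ones and accounts for one more factor \<eta>.\<close>
  have "?P {x. S \<subseteq> ones x \<and> chain l (ones x) (Suc k) i}
      \<le> ?P (\<Union>g\<in>{1..l}. {x. insert i S \<subseteq> ones x \<and> chain l (ones x) k (i + g)})"
    by (intro measure_pmf.finite_measure_mono) auto
  also have "\<dots> \<le> (\<Sum>g\<in>{1..l}. ?P {x. insert i S \<subseteq> ones x \<and> chain l (ones x) k (i + g)})"
    by (rule measure_pmf.finite_measure_subadditive_finite) auto
  also have "\<dots> \<le> (\<Sum>g\<in>{1..l}. \<eta> ^ (card (insert i S) + 1) * (\<eta> * l) ^ k)"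
    by (intro sum_mono Suc.IH) (use Suc.prems in force)
  also have "\<dots> = \<eta> ^ (card S + 1) * (\<eta> * l) ^ Suc k"
    using fin by simp
  finally show ?case .
qed

text \<open>Union bound over the starting point of a chain, with no ones visited before it.\<close>

lemma prob_not_chainless_le:
  assumes \<eta>: "0 \<le> \<eta>" "\<eta> \<le> 1"
  shows "measure_pmf.prob (random_string n \<eta>) (- chainless n l k) \<le> n * (\<eta> * l) ^ k"
proof -
  let ?P = "measure_pmf.prob (random_string n \<eta>)"
  have "i < n" if "chain l (ones x) k i" "length x = n" for x i
    using that chain_antimono[of l "ones x" k i 0] by (auto simp: ones_def)
  hence "?P (- chainless n l k) \<le> ?P (\<Union>i<n. {x. {} \<subseteq> ones x \<and> chain l (ones x) k i})"
    by (intro measure_pmf.finite_measure_mono_AE)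
       (auto simp: AE_measure_pmf_iff random_string_def set_replicate_pmf chainless_def)
  also have "\<dots> \<le> (\<Sum>i<n. ?P {x. {} \<subseteq> ones x \<and> chain l (ones x) k i})"
    by (rule measure_pmf.finite_measure_subadditive_finite) auto
  also have "\<dots> \<le> (\<Sum>i<n. \<eta> ^ (card ({} :: nat set) + 1) * (\<eta> * l) ^ k)"
    by (intro sum_mono prob_chain_le \<eta>) auto
  also have "\<dots> = n * (\<eta> * (\<eta> * l) ^ k)"
    by simp
  also have "\<dots> \<le> n * (1 * (\<eta> * l) ^ k)"
    using \<eta> by (intro mult_left_mono mult_right_mono) auto
  finally show ?thesis by simp
qed

section \<open>Positions in a trace\<close>

text \<open>With \<open>A\<close> the set of surviving coordinates, this is the trace position of a
  survivor \<open>i\<close>; it is also meaningful for deleted \<open>i\<close>, as the number of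
  survivors before it.\<close>

definition rank :: "nat set \<Rightarrow> nat \<Rightarrow> nat" where
  "rank A i = card {j\<in>A. j < i}"

lemma rank_le: "rank A i \<le> i"
  unfolding rank_def using card_mono[of "{..<i}" "{j\<in>A. j < i}"] by auto

lemma rank_strict_mono: "strict_mono_on A (rank A)"
proof (rule strict_mono_onI)
  fix i j assume "i \<in> A" "j \<in> A" "i < j"
  thus "rank A i < rank A j" unfolding rank_def by (intro psubset_card_mono) auto
qed

lemma inj_on_rank: "inj_on (rank A) A"
  by (rule strict_mono_on_imp_inj_on[OF rank_strict_mono])

lemma rank_sorted_nth:
  assumes "sorted_wrt (<) xs" "j < length xs"
  shows "rank (set xs) (xs ! j) = j"
proof -
  have iff: "xs ! i < xs ! j \<longleftrightarrow> i < j" if "i < length xs" for i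
    using assms that sorted_wrt_nth_less[of "(<)" xs] by (metis linorder_neqE_nat order_less_asym)
  have "{i\<in>set xs. i < xs ! j} = (!) xs ` {..<j}"
    using assms(2) iff by (safe, metis imageI in_set_conv_nth lessThan_iff, simp_all)
  moreover have "inj_on ((!) xs) {..<j}"
    using assms by (intro inj_on_nth) (auto simp: strict_sorted_iff)
  ultimately show ?thesis by (simp add: rank_def card_image)
qed

text \<open>Appending a bit does not change earlier ranks, and a surviving last bit lands at
  position \<open>length (nths x A) = rank A (length x)\<close>.\<close>

lemma ones_nths: "ones (nths x A) = rank A ` (ones x \<inter> A)"
proof (induction x rule: rev_induct)
  case Nil
  show ?case by (simp add: ones_def)
next
  case (snoc b x)
  have snoc_ones: "ones (xs @ ys) = ones xs \<union> (\<lambda>i. i + length xs) ` ones ys" for xs ys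
  proof (intro set_eqI iffI)
    fix i assume "i \<in> ones (xs @ ys)"
    thus "i \<in> ones xs \<union> (\<lambda>i. i + length xs) ` ones ys"
      by (cases "i < length xs") (auto simp: ones_def nth_append intro!: image_eqI[of _ _ "i - length xs"])
  qed (auto simp: ones_def nth_append)
  have single: "ones [b] = (if b then {0} else {})" "ones [] = {}" by (auto simp: ones_def)
  have "length (nths x A) = rank A (length x)"
    by (simp add: length_nths rank_def conj_commute)
  thus ?case
    by (auto simp: nths_append snoc_ones snoc.IH single)
qed

section \<open>Surviving coordinates and their drift\<close>

definition kept :: "bool list \<Rightarrow> nat set" where
  "kept ds = {i. \<not> ds ! i}"

abbreviation coins :: "nat \<Rightarrow> bool list pmf" where
  "coins n \<equiv> replicate_pmf n (bernoulli_pmf (1/2))"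

lemma deletion_channel_half_eq:
  "deletion_channel (1/2) x = map_pmf (\<lambda>ds. nths x (kept ds)) (coins (length x))"
  by (simp add: deletion_channel_def kept_def)

lemma integrable_coins [simp, intro]:
  fixes f :: "bool list \<Rightarrow> real"
  shows "integrable (coins n) f"
proof (rule integrable_measure_pmf_finite)
  show "finite (set_pmf (coins n))"
    using finite_lists_length_eq[of "UNIV :: bool set" n]
    by (rule finite_subset[rotated]) (auto simp: set_replicate_pmf)
qed

lemma prob_subset_kept:
  assumes "S \<subseteq> {..<n}"
  shows "measure_pmf.prob (coins n) {ds. S \<subseteq> kept ds} = (1/2) ^ card S"
  using prob_replicate_pmf_all[OF assms, of "bernoulli_pmf (1/2)" "{False}"]
  by (simp add: measure_pmf_single kept_def subset_iff Ball_def)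

text \<open>The exceptional event of the channel. It depends on the coins alone, so one bound serves
  all sources of length \<open>n\<close>.\<close>

definition drift :: "nat \<Rightarrow> real \<Rightarrow> bool list set" where
  "drift n \<delta> = {ds. \<exists>i\<le>n. \<bar>real (rank (kept ds) i) - real i / 2\<bar> \<ge> \<delta>}"

lemma abs_rank_kept_less: "ds \<notin> drift n \<delta> \<Longrightarrow> i \<le> n \<Longrightarrow> \<bar>real (rank (kept ds) i) - real i / 2\<bar> < \<delta>"
  unfolding drift_def by (metis (mono_tags, lifting) mem_Collect_eq not_le)

lemma rank_kept_conv_sum_list:
  assumes "i \<le> length ds"
  shows "real (rank (kept ds) i) = (\<Sum>d\<leftarrow>take i ds. of_bool (\<not> d))"
proof -
  have "(\<Sum>d\<leftarrow>take i ds. of_bool (\<not> d)) = (\<Sum>j<i. of_bool (\<not> ds ! j) :: real)"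
    using assms by (simp add: sum_list_sum_nth atLeast0LessThan min.absorb1 del: sum_of_bool_eq)
  also have "\<dots> = real (card ({..<i} \<inter> {j. \<not> ds ! j}))"
    by simp
  also have "{..<i} \<inter> {j. \<not> ds ! j} = {j\<in>kept ds. j < i}"
    by (auto simp: kept_def)
  finally show ?thesis by (simp add: rank_def)
qed

text \<open>Hoeffding's inequality for each prefix of the coins, and a union bound over the
  \<open>n + 1\<close> prefix lengths.\<close>

lemma prob_drift_le:
  assumes \<delta>: "\<delta> > 0"
  shows "measure_pmf.prob (coins n) (drift n \<delta>) \<le> (n + 1) * (2 * exp (- 2 * \<delta>\<^sup>2 / n))"
proof -
  let ?f = "\<lambda>d. of_bool (\<not> d) :: real"
  have "measure_pmf.prob (coins n) (drift n \<delta>)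
      \<le> measure_pmf.prob (coins n) (\<Union>i\<in>{..n}. {ds. \<bar>(\<Sum>d\<leftarrow>take i ds. ?f d) - real i * (1/2)\<bar> \<ge> \<delta>})"
    by (intro measure_pmf.finite_measure_mono_AE)
       (auto simp: AE_measure_pmf_iff set_replicate_pmf drift_def rank_kept_conv_sum_list)
  also have "\<dots> \<le> (\<Sum>i\<in>{..n}. measure_pmf.prob (coins n)
       {ds. \<bar>(\<Sum>d\<leftarrow>take i ds. ?f d) - real i * (1/2)\<bar> \<ge> \<delta>})"
    by (rule measure_pmf.finite_measure_subadditive_finite) auto
  also have "\<dots> \<le> (\<Sum>i\<in>{..n}. 2 * exp (- 2 * \<delta>\<^sup>2 / n))"
  proof (rule sum_mono)
    fix i assume "i \<in> {..n}"
    hence i: "i \<le> n" by simp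
    show "measure_pmf.prob (coins n) {ds. \<bar>(\<Sum>d\<leftarrow>take i ds. ?f d) - real i * (1/2)\<bar> \<ge> \<delta>}
        \<le> 2 * exp (- 2 * \<delta>\<^sup>2 / n)"
    proof (cases "i = 0")
      case True
      thus ?thesis using \<delta> by simp
    next
      case False
      have E: "measure_pmf.expectation (bernoulli_pmf (1/2)) ?f = 1/2"
        by simp
      have "measure_pmf.prob (coins n) {ds. \<bar>(\<Sum>d\<leftarrow>take i ds. ?f d) - real i * (1/2)\<bar> \<ge> \<delta>}
          = measure_pmf.prob (map_pmf (take i) (coins n)) {ds. \<bar>(\<Sum>d\<leftarrow>ds. ?f d) - real i * (1/2)\<bar> \<ge> \<delta>}"
        by (simp add: vimage_def)
      also have "\<dots> \<le> 2 * exp (- 2 * \<delta>\<^sup>2 / i)"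
        unfolding map_take_replicate_pmf[OF i]
        using replicate_pmf_Hoeffding[of ?f \<delta> i "bernoulli_pmf (1/2)"] \<delta> unfolding E by simp
      also have "\<dots> \<le> 2 * exp (- 2 * \<delta>\<^sup>2 / n)"
        using i False by (simp add: frac_le)
      finally show ?thesis .
    qed
  qed
  finally show ?thesis by (simp add: add.commute)
qed

text \<open>The bounds \<open>u\<close> and \<open>v\<close> are source positions; the trace is shorter by a factor of about 2.\<close>

definition window :: "real \<Rightarrow> real \<Rightarrow> bool list \<Rightarrow> nat set" where
  "window u v y = {t\<in>ones y. u / 2 \<le> real t \<and> real t \<le> v / 2}"

text \<open>A displacement below \<delta> in the trace amounts to one below 2\<delta> in the source,
  so the window shows only ones from the widened interval. Conversely, survivors from the interval
  narrowed by 2\<delta> cannot leave it.\<close>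

lemma window_subset:
  fixes u v \<delta> :: real
  assumes "ds \<notin> drift (length x) \<delta>"
  shows "window u v (nths x (kept ds))
           \<subseteq> rank (kept ds) ` ({i\<in>ones x. u - 2 * \<delta> < real i \<and> real i < v + 2 * \<delta>} \<inter> kept ds)"
proof
  fix t assume "t \<in> window u v (nths x (kept ds))"
  then obtain i where i: "i \<in> ones x" "i \<in> kept ds" "t = rank (kept ds) i" "u / 2 \<le> real t" "real t \<le> v / 2"
    by (auto simp: window_def ones_nths)
  have "i < length x" using i by (simp add: ones_def)
  hence "\<bar>real t - real i / 2\<bar> < \<delta>" using abs_rank_kept_less[OF assms, of i] i(3) by simp
  hence "u - 2 * \<delta> < real i" "real i < v + 2 * \<delta>" using i by argo+
  thus "t \<in> rank (kept ds) ` ({i\<in>ones x. u - 2 * \<delta> < real i \<and> real i < v + 2 * \<delta>} \<inter> kept ds)"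
    using i by auto
qed

lemma window_supset:
  fixes u v \<delta> :: real
  assumes "ds \<notin> drift (length x) \<delta>"
  shows "rank (kept ds) ` ({i\<in>ones x. u + 2 * \<delta> \<le> real i \<and> real i \<le> v - 2 * \<delta>} \<inter> kept ds)
           \<subseteq> window u v (nths x (kept ds))"
proof clarify
  fix i assume i: "i \<in> ones x" "i \<in> kept ds" "u + 2 * \<delta> \<le> real i" "real i \<le> v - 2 * \<delta>"
  have "i < length x" using i by (simp add: ones_def)
  hence "\<bar>real (rank (kept ds) i) - real i / 2\<bar> < \<delta>" using abs_rank_kept_less[OF assms] by simp
  thus "rank (kept ds) i \<in> window u v (nths x (kept ds))" using i
    by (auto simp: window_def ones_nths)
qed

lemma finite_window [simp, intro]: "finite (window u v y)"
  by (simp add: window_def)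

section \<open>Distinguishing two sources\<close>

text \<open>For \<open>x\<close> the event requires drift. For \<open>x'\<close> it occurs without
  drift as soon as \<open>m + 1\<close> fixed ones survive. Each source costs the drift probability
  once.\<close>

lemma count_test:
  fixes x x' :: "bool list" and u v \<delta> :: real
  assumes len: "length x = n" "length x' = n"
    and few: "card {i\<in>ones x. u - 2 * \<delta> < real i \<and> real i < v + 2 * \<delta>} \<le> m"
    and many: "m < card {i\<in>ones x'. u + 2 * \<delta> \<le> real i \<and> real i \<le> v - 2 * \<delta>}"
  defines "f \<equiv> (\<lambda>y. of_bool (m < card (window u v y)) :: real)"
  shows "measure_pmf.expectation (deletion_channel (1/2) x') f
           - measure_pmf.expectation (deletion_channel (1/2) x) f
           \<ge> (1/2) ^ Suc m - 2 * measure_pmf.prob (coins n) (drift n \<delta>)"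
proof -
  let ?P = "measure_pmf.prob (coins n)"
  have E: "measure_pmf.expectation (deletion_channel (1/2) z) f
      = ?P {ds. m < card (window u v (nths z (kept ds)))}" if "length z = n" for z
  proof -
    have f: "f = indicator {y. m < card (window u v y)}"
      by (auto simp: f_def indicator_def)
    show ?thesis using that by (simp add: deletion_channel_half_eq f vimage_def)
  qed
  have "?P {ds. m < card (window u v (nths x (kept ds)))} \<le> ?P (drift n \<delta>)"
  proof (intro measure_pmf.finite_measure_mono subsetI, rule ccontr)
    fix ds assume ds: "ds \<in> {ds. m < card (window u v (nths x (kept ds)))}" "ds \<notin> drift n \<delta>"
    let ?B = "{i\<in>ones x. u - 2 * \<delta> < real i \<and> real i < v + 2 * \<delta>}"
    have "card (window u v (nths x (kept ds))) \<le> card (rank (kept ds) ` (?B \<inter> kept ds))"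
      by (intro card_mono window_subset) (use len ds in auto)
    also have "\<dots> \<le> card (?B \<inter> kept ds)" by (intro card_image_le) auto
    also have "\<dots> \<le> card ?B" by (intro card_mono) auto
    finally show False using few ds by simp
  qed auto
  moreover have "(1/2) ^ Suc m - ?P (drift n \<delta>) \<le> ?P {ds. m < card (window u v (nths x' (kept ds)))}"
  proof -
    obtain S where S: "S \<subseteq> {i\<in>ones x'. u + 2 * \<delta> \<le> real i \<and> real i \<le> v - 2 * \<delta>}" "card S = Suc m" "finite S"
      by (rule obtain_subset_with_card_n[OF Suc_leI[OF many]])
    have "(1/2) ^ Suc m = ?P {ds. S \<subseteq> kept ds}"
      using S len by (subst prob_subset_kept) (auto simp: ones_def)
    also have "\<dots> \<le> ?P ({ds. m < card (window u v (nths x' (kept ds)))} \<union> drift n \<delta>)"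
    proof (intro measure_pmf.finite_measure_mono)
      show "{ds. S \<subseteq> kept ds} \<subseteq> {ds. m < card (window u v (nths x' (kept ds)))} \<union> drift n \<delta>"
      proof clarify
        fix ds assume ds: "S \<subseteq> kept ds" "ds \<notin> drift n \<delta>"
        have "rank (kept ds) ` S \<subseteq> window u v (nths x' (kept ds))"
          by (rule order_trans[OF image_mono window_supset]) (use len ds S in auto)
        hence "card (rank (kept ds) ` S) \<le> card (window u v (nths x' (kept ds)))"
          by (intro card_mono) auto
        thus "m < card (window u v (nths x' (kept ds)))"
          using S ds card_image[OF inj_on_subset[OF inj_on_rank ds(1)]] by simp
      qed
    qed auto
    also have "\<dots> \<le> ?P {ds. m < card (window u v (nths x' (kept ds)))} + ?P (drift n \<delta>)"
      by (rule measure_Un_le) auto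
    finally show ?thesis by simp
  qed
  ultimately show ?thesis using E len by simp
qed

text \<open>Given that \<open>S\<close> survives, an index below \<open>p\<close> survives with
  probability 1 if it is in \<open>S\<close> and 1/2 otherwise. So the conditional mean is
  \<open>(p + rank S p) / 2\<close>, which reveals \<open>p\<close> once its rank is known.\<close>

lemma expectation_rank_kept:
  assumes S: "S \<subseteq> {..<n}" and p: "p \<le> n"
  shows "measure_pmf.expectation (coins n) (\<lambda>ds. of_bool (S \<subseteq> kept ds) * real (rank (kept ds) p))
           = (1/2) ^ Suc (card S) * real (p + rank S p)"
proof -
  have fin: "finite S" using S finite_subset by blast
  have "of_bool (S \<subseteq> kept ds) * real (rank (kept ds) p)
      = (\<Sum>i<p. indicator {ds. insert i S \<subseteq> kept ds} ds)" for ds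
  proof -
    have "{i\<in>kept ds. i < p} = {..<p} \<inter> {i. i \<in> kept ds}" by auto
    hence "real (rank (kept ds) p) = (\<Sum>i<p. of_bool (i \<in> kept ds))"
      by (simp add: rank_def)
    thus ?thesis by (auto simp: sum_distrib_left indicator_def intro!: sum.cong)
  qed
  hence "measure_pmf.expectation (coins n) (\<lambda>ds. of_bool (S \<subseteq> kept ds) * real (rank (kept ds) p))
      = (\<Sum>i<p. measure_pmf.prob (coins n) {ds. insert i S \<subseteq> kept ds})"
    by (simp only:) (subst Bochner_Integration.integral_sum, simp_all)
  also have "\<dots> = (\<Sum>i<p. (1/2) ^ Suc (card S) * (1 + of_bool (i \<in> S)))"
    using S p fin by (intro sum.cong refl, subst prob_subset_kept) (auto simp: card_insert_if)
  also have "\<dots> = (1/2) ^ Suc (card S) * (real p + (\<Sum>i<p. of_bool (i \<in> S)))"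
    by (simp add: sum_distrib_left[symmetric] sum.distrib del: power_Suc)
  also have "(\<Sum>i<p. of_bool (i \<in> S)) = real (rank S p)"
  proof -
    have "{i\<in>S. i < p} = {..<p} \<inter> {i. i \<in> S}" by auto
    thus ?thesis by (simp add: rank_def)
  qed
  finally show ?thesis by simp
qed

text \<open>The truncation \<open>min 1\<close> only matters for lists longer than \<open>n\<close>, which are not traces.\<close>

lemma expectation_position_test:
  fixes x :: "bool list" and u v \<delta> :: real
  assumes len: "length x = n" and n: "n > 0"
    and S_big: "{i\<in>ones x. u - 2 * \<delta> < real i \<and> real i < v + 2 * \<delta>} = S"
    and S_small: "{i\<in>ones x. u + 2 * \<delta> \<le> real i \<and> real i \<le> v - 2 * \<delta>} = S"
    and m: "card S = m" and j: "j < m"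
  defines "f \<equiv> (\<lambda>y. of_bool (card (window u v y) = m) * min 1 (real (sorted_list_of_set (window u v y) ! j) / n))"
  shows "\<bar>measure_pmf.expectation (deletion_channel (1/2) x) f
           - (1/2) ^ Suc m * real (sorted_list_of_set S ! j + j) / n\<bar>
           \<le> measure_pmf.prob (coins n) (drift n \<delta>)"
proof -
  define p where "p = sorted_list_of_set S ! j"
  \<comment> \<open>The idealised statistic: the window is replaced by the event that
    \<open>S\<close> survives. It agrees with \<open>f\<close> on traces without drift, and its mean
    is known exactly.\<close>
  define g where "g = (\<lambda>ds. of_bool (S \<subseteq> kept ds) * real (rank (kept ds) p) / n)"
  have S: "finite S" "S \<subseteq> {..<n}" using S_big len by (auto simp: ones_def)
  have pS: "p \<in> S" using nth_mem[of j "sorted_list_of_set S"] S j m by (simp add: p_def)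
  have rank_p: "rank S p = j"
    using rank_sorted_nth[of "sorted_list_of_set S" j] S j m by (simp add: p_def)
  have pn: "p \<le> n" using pS S by auto
  have "measure_pmf.expectation (coins n) g
      = measure_pmf.expectation (coins n) (\<lambda>ds. of_bool (S \<subseteq> kept ds) * real (rank (kept ds) p)) / n"
    unfolding g_def by simp
  hence Eg: "measure_pmf.expectation (coins n) g = (1/2) ^ Suc m * real (p + j) / n"
    using expectation_rank_kept[OF S(2) pn] m rank_p by simp
  have fg: "\<bar>f (nths x (kept ds)) - g ds\<bar> \<le> indicator (drift n \<delta>) ds" for ds
  proof -
    have f01: "0 \<le> f y" "f y \<le> 1" for y by (auto simp: f_def)
    have "rank (kept ds) p \<le> n" using rank_le[of "kept ds" p] pn by simp
    hence g01: "0 \<le> g ds" "g ds \<le> 1" using n by (auto simp: g_def)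
    show ?thesis
    proof (cases "ds \<in> drift n \<delta>")
      case True
      thus ?thesis using f01[of "nths x (kept ds)"] g01 by (simp add: abs_le_iff)
    next
      case False
      let ?W = "window u v (nths x (kept ds))"
      have W: "?W = rank (kept ds) ` (S \<inter> kept ds)"
        using window_subset[of ds x \<delta> u v] window_supset[of ds x \<delta> u v] False
        unfolding len S_big S_small by blast
      have inj: "inj_on (rank (kept ds)) (S \<inter> kept ds)"
        by (rule inj_on_subset[OF inj_on_rank]) auto
      have card: "card ?W = card (S \<inter> kept ds)"
        unfolding W by (rule card_image[OF inj])
      show ?thesis
      proof (cases "S \<subseteq> kept ds")
        case False
        \<comment> \<open>If a one of the cluster is deleted, the window shows fewer than
          \<open>m\<close> ones and both statistics vanish.\<close>
        hence "S \<inter> kept ds \<subset> S" by auto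
        hence "card ?W < m" using psubset_card_mono[OF S(1)] card m by metis
        thus ?thesis using False by (simp add: f_def g_def)
      next
        case True
        hence SI: "S \<inter> kept ds = S" by auto
        \<comment> \<open>Deletion preserves the order, so the \<open>j\<close>-th one shown is the
          image of the \<open>j\<close>-th element of the cluster.\<close>
        have "sorted_list_of_set ?W = map (rank (kept ds)) (sorted_list_of_set S)"
        proof (rule sorted_list_of_set_unique[THEN iffD1])
          have "sorted_wrt (\<lambda>i j. rank (kept ds) i < rank (kept ds) j) (sorted_list_of_set S)"
            by (rule sorted_wrt_mono_rel[OF _ strict_sorted_list_of_set])
               (use S True in \<open>auto intro!: strict_mono_onD[OF rank_strict_mono]\<close>)
          moreover have "length (map (rank (kept ds)) (sorted_list_of_set S)) = card ?W"
            using card SI by simp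
          ultimately show "sorted_wrt (<) (map (rank (kept ds)) (sorted_list_of_set S)) \<and>
              set (map (rank (kept ds)) (sorted_list_of_set S)) = ?W \<and>
              length (map (rank (kept ds)) (sorted_list_of_set S)) = card ?W"
            using S by (simp add: sorted_wrt_map W SI)
        qed auto
        hence "sorted_list_of_set ?W ! j = rank (kept ds) p"
          using j m S by (simp add: p_def)
        thus ?thesis using True card SI m g01 by (simp add: f_def g_def)
      qed
    qed
  qed
  have "\<bar>measure_pmf.expectation (coins n) (\<lambda>ds. f (nths x (kept ds))) - measure_pmf.expectation (coins n) g\<bar>
      = \<bar>measure_pmf.expectation (coins n) (\<lambda>ds. f (nths x (kept ds)) - g ds)\<bar>"
    by (subst Bochner_Integration.integral_diff[OF integrable_coins integrable_coins]) simp
  also have "\<dots> \<le> measure_pmf.expectation (coins n) (\<lambda>ds. \<bar>f (nths x (kept ds)) - g ds\<bar>)"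
    by (rule integral_abs_bound)
  also have "\<dots> \<le> measure_pmf.expectation (coins n) (indicator (drift n \<delta>))"
    by (intro integral_mono integrable_coins fg)
  finally show ?thesis
    unfolding Eg by (simp add: deletion_channel_half_eq len p_def)
qed

text \<open>Some \<open>j\<close>-th ones of the two clusters differ, by at least 1 as they are
  integers. The common shift \<open>j\<close> cancels in the difference of the means, and each
  approximation costs the drift probability once.\<close>

lemma position_test:
  fixes x x' :: "bool list" and u v \<delta> :: real
  assumes len: "length x = n" "length x' = n"
    and S_big: "{i\<in>ones x. u - 2 * \<delta> < real i \<and> real i < v + 2 * \<delta>} = S"
    and S_small: "{i\<in>ones x. u + 2 * \<delta> \<le> real i \<and> real i \<le> v - 2 * \<delta>} = S"
    and S'_big: "{i\<in>ones x'. u - 2 * \<delta> < real i \<and> real i < v + 2 * \<delta>} = S'"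
    and S'_small: "{i\<in>ones x'. u + 2 * \<delta> \<le> real i \<and> real i \<le> v - 2 * \<delta>} = S'"
    and card: "card S = m" "card S' = m" and ne: "S \<noteq> S'"
  shows "\<exists>f :: bool list \<Rightarrow> real. (\<forall>y. f y \<in> {0..1}) \<and>
           \<bar>measure_pmf.expectation (deletion_channel (1/2) x) f
             - measure_pmf.expectation (deletion_channel (1/2) x') f\<bar>
           \<ge> (1/2) ^ Suc m / n - 2 * measure_pmf.prob (coins n) (drift n \<delta>)"
proof -
  have fin: "finite S" "finite S'" using S_big S'_big by auto
  have "sorted_list_of_set S \<noteq> sorted_list_of_set S'"
    using ne fin sorted_list_of_set_inject by blast
  then obtain j where j: "j < m" "sorted_list_of_set S ! j \<noteq> sorted_list_of_set S' ! j"
    using card by (auto simp: list_eq_iff_nth_eq)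
  have n: "n > 0" using len S_big card j fin by (auto simp: ones_def)
  let ?p = "sorted_list_of_set S ! j" and ?p' = "sorted_list_of_set S' ! j"
  define f where "f = (\<lambda>y. of_bool (card (window u v y) = m) * min 1 (real (sorted_list_of_set (window u v y) ! j) / n))"
  let ?E = "\<lambda>x. measure_pmf.expectation (deletion_channel (1/2) x) f"
  note E = expectation_position_test[OF len(1) n S_big S_small card(1) j(1), folded f_def]
    expectation_position_test[OF len(2) n S'_big S'_small card(2) j(1), folded f_def]
  have "(1/2) ^ Suc m / n \<le> (1/2) ^ Suc m * \<bar>real ?p - real ?p'\<bar> / n"
    using j n by (intro divide_right_mono) auto
  also have "\<dots> = \<bar>(1/2) ^ Suc m * real (?p + j) / n - (1/2) ^ Suc m * real (?p' + j) / n\<bar>"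
    by (simp add: abs_mult flip: diff_divide_distrib right_diff_distrib del: power_Suc)
  finally have "(1/2) ^ Suc m / n - 2 * measure_pmf.prob (coins n) (drift n \<delta>) \<le> \<bar>?E x - ?E x'\<bar>"
    using E by linarith
  thus ?thesis by (intro exI[of _ f]) (auto simp: f_def)
qed

section \<open>Combining the tests for chainless strings\<close>

definition distinguishable :: "real \<Rightarrow> bool list \<Rightarrow> bool list \<Rightarrow> bool" where
  "distinguishable \<epsilon> x x' \<longleftrightarrow> (\<exists>f :: bool list \<Rightarrow> real. (\<forall>y. f y \<in> {0..1}) \<and>
     \<bar>measure_pmf.expectation (deletion_channel (1/2) x) f
       - measure_pmf.expectation (deletion_channel (1/2) x') f\<bar> \<ge> \<epsilon>)"

lemma distinguishable_sym: "distinguishable \<epsilon> x x' \<Longrightarrow> distinguishable \<epsilon> x' x"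
  unfolding distinguishable_def by (subst abs_minus_commute)

lemma distinguishable_antimono: "distinguishable \<epsilon> x x' \<Longrightarrow> \<epsilon>' \<le> \<epsilon> \<Longrightarrow> distinguishable \<epsilon>' x x'"
  unfolding distinguishable_def by (meson order_trans)

text \<open>The factor 12 splits as 6 + 2 + 4: the window extends 6\<delta> beyond a cluster, drift
  adds 2\<delta>, and a one of the other string may be 4\<delta> away from its partner.\<close>

context
  fixes n l k :: nat and \<delta> \<epsilon> :: real
  assumes \<delta>: "\<delta> > 0" and l: "12 * \<delta> < real l + 1"
  defines "\<epsilon> \<equiv> (1/2) ^ Suc k / n - 2 * measure_pmf.prob (coins n) (drift n \<delta>)"
begin

lemma \<epsilon>_le:
  assumes "m \<le> k"
  shows "\<epsilon> \<le> (1/2) ^ Suc m / n - 2 * measure_pmf.prob (coins n) (drift n \<delta>)"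
proof -
  have "(1/2 :: real) ^ Suc k \<le> (1/2) ^ Suc m"
    using assms by (intro power_decreasing) auto
  hence "(1/2 :: real) ^ Suc k / n \<le> (1/2) ^ Suc m / n"
    by (intro divide_right_mono) auto
  thus ?thesis by (simp add: \<epsilon>_def)
qed

lemma distinguishable_if_count:
  assumes len: "length x = n" "length x' = n" and m: "m \<le> k"
    and few: "card {i\<in>ones x. u - 2 * \<delta> < real i \<and> real i < v + 2 * \<delta>} \<le> m"
    and many: "m < card {i\<in>ones x'. u + 2 * \<delta> \<le> real i \<and> real i \<le> v - 2 * \<delta>}"
  shows "distinguishable \<epsilon> x x'"
proof -
  have "{i\<in>ones x'. u + 2 * \<delta> \<le> real i \<and> real i \<le> v - 2 * \<delta>} \<noteq> {}"
    using many by (metis card.empty not_less0)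
  hence "n > 0" using len by (auto simp: ones_def)
  hence "(1/2 :: real) ^ Suc m / n \<le> (1/2) ^ Suc m / 1"
    by (intro divide_left_mono) auto
  thus ?thesis
    using count_test[OF len few many] \<epsilon>_le[OF m] unfolding distinguishable_def
    by (intro exI[of _ "\<lambda>y. of_bool (m < card (window u v y))"]) auto
qed

text \<open>The counting test with \<open>m = 0\<close> on the window of radius 2\<delta> around
  \<open>p\<close>: narrowed it is \<open>p\<close> alone, widened it stays within 4\<delta>, where
  \<open>x\<close> has no ones.\<close>

lemma distinguishable_if_isolated:
  assumes len: "length x = n" "length x' = n" and p: "p \<in> ones x'"
    and isolated: "\<And>i. i \<in> ones x \<Longrightarrow> \<bar>real i - real p\<bar> \<ge> 4 * \<delta>"
  shows "distinguishable \<epsilon> x x'"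
proof (rule distinguishable_if_count[OF len le0])
  have "{i\<in>ones x. real p - 2 * \<delta> - 2 * \<delta> < real i \<and> real i < real p + 2 * \<delta> + 2 * \<delta>} = {}"
    using isolated by fastforce
  thus "card {i\<in>ones x. real p - 2 * \<delta> - 2 * \<delta> < real i \<and> real i < real p + 2 * \<delta> + 2 * \<delta>} \<le> 0"
    by (metis card.empty order_refl)
  show "0 < card {i\<in>ones x'. real p - 2 * \<delta> + 2 * \<delta> \<le> real i \<and> real i \<le> real p + 2 * \<delta> - 2 * \<delta>}"
    using p by (auto simp: card_gt_0_iff)
qed

text \<open>A window isolates the cluster of \<open>p\<close> in both strings. If the two counts
  differ, the smaller one is at most \<open>k\<close> and serves as threshold of the counting test;
  if they agree, the sets differ at \<open>p\<close> and the position test applies.\<close>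

lemma distinguishable_if_aligned:
  assumes x: "x \<in> chainless n l k" and len': "length x' = n"
    and near: "\<And>i. i \<in> ones x' \<Longrightarrow> \<exists>j\<in>ones x. \<bar>real j - real i\<bar> < 4 * \<delta>"
    and p: "p \<in> ones x" "p \<notin> ones x'"
  shows "distinguishable \<epsilon> x x'"
proof -
  have len: "length x = n" and no_chain: "\<And>i. \<not> chain l (ones x) k i"
    using x by (auto simp: chainless_def)
  obtain a b where ab: "a \<in> ones x" "b \<in> ones x" "a \<le> p" "p \<le> b" "card (ones x \<inter> {a..b}) \<le> k"
    and left: "\<And>i. i \<in> ones x \<Longrightarrow> i < a \<Longrightarrow> i + l < a"
    and right: "\<And>i. i \<in> ones x \<Longrightarrow> b < i \<Longrightarrow> b + l < i"
    by (rule cluster_exists[OF finite_ones p(1) no_chain]) (rule that)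
  have cluster: "i \<in> {a..b}" if "i \<in> ones x" "real a - 12 * \<delta> < real i" "real i < real b + 12 * \<delta>" for i
  proof (rule ccontr)
    assume "i \<notin> {a..b}"
    hence "i + l + 1 \<le> a \<or> b + l + 1 \<le> i" using left[of i] right[of i] that by force
    hence "real i + real l + 1 \<le> real a \<or> real b + real l + 1 \<le> real i" by linarith
    thus False using that l by linarith
  qed
  \<comment> \<open>Ones of \<open>x'\<close> that the window can show lie within \<open>4 * \<delta>\<close> of \<open>[a, b]\<close>, so with a margin of
    \<open>6 * \<delta>\<close> they are all surely shown when they survive.\<close>
  define u where "u = real a - 6 * \<delta>"
  define v where "v = real b + 6 * \<delta>"
  define S where "S = ones x \<inter> {a..b}"
  define S' where "S' = {i\<in>ones x'. u - 2 * \<delta> < real i \<and> real i < v + 2 * \<delta>}"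
  have S_big: "{i\<in>ones x. u - 2 * \<delta> < real i \<and> real i < v + 2 * \<delta>} = S"
    using cluster \<delta> by (fastforce simp: S_def u_def v_def)
  have S_small: "{i\<in>ones x. u + 2 * \<delta> \<le> real i \<and> real i \<le> v - 2 * \<delta>} = S"
    using cluster \<delta> by (fastforce simp: S_def u_def v_def)
  have S'_small: "{i\<in>ones x'. u + 2 * \<delta> \<le> real i \<and> real i \<le> v - 2 * \<delta>} = S'"
  proof (intro set_eqI iffI)
    fix i assume "i \<in> S'"
    hence i: "i \<in> ones x'" "real a - 8 * \<delta> < real i" "real i < real b + 8 * \<delta>"
      by (auto simp: S'_def u_def v_def)
    obtain j where j: "j \<in> ones x" "\<bar>real j - real i\<bar> < 4 * \<delta>" using near i by blast
    have "j \<in> {a..b}" by (rule cluster) (use i j in linarith)+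
    hence "real a \<le> real j" "real j \<le> real b" by auto
    hence "real a - 4 * \<delta> \<le> real i" "real i \<le> real b + 4 * \<delta>" using j by linarith+
    thus "i \<in> {i\<in>ones x'. u + 2 * \<delta> \<le> real i \<and> real i \<le> v - 2 * \<delta>}"
      using i by (simp add: u_def v_def)
  qed (use \<delta> in \<open>auto simp: S'_def\<close>)
  have card_S: "card S \<le> k" using ab by (simp add: S_def)
  consider "card S < card S'" | "card S' < card S" | "card S' = card S" by linarith
  thus ?thesis
  proof cases
    case 1
    show ?thesis
      by (rule distinguishable_if_count[OF len len' card_S, of u v]) (use 1 S_big S'_small in simp_all)
  next
    case 2
    have "distinguishable \<epsilon> x' x"
      by (rule distinguishable_if_count[OF len' len, of "card S'" u v])
         (use 2 card_S S_small in \<open>simp_all add: S'_def\<close>)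
    thus ?thesis by (rule distinguishable_sym)
  next
    case 3
    have "p \<in> S" "p \<notin> S'" using p ab by (simp_all add: S_def S'_def)
    hence "S \<noteq> S'" by blast
    hence "distinguishable ((1/2) ^ Suc (card S) / n - 2 * measure_pmf.prob (coins n) (drift n \<delta>)) x x'"
      unfolding distinguishable_def
      by (intro position_test[OF len len' S_big S_small S'_def[symmetric] S'_small refl 3])
    thus ?thesis by (rule distinguishable_antimono) (rule \<epsilon>_le[OF card_S])
  qed
qed

text \<open>Either a one of one string is at least 4\<delta> away from all ones of the other, or
  each one has a partner within 4\<delta> in the other string.\<close>

lemma chainless_distinguishable:
  assumes x: "x \<in> chainless n l k" and x': "x' \<in> chainless n l k" and ne: "x \<noteq> x'"
  shows "distinguishable \<epsilon> x x'"
proof -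
  have len: "length x = n" "length x' = n" using x x' by (auto simp: chainless_def)
  consider (isolated) p where "p \<in> ones x" "\<And>i. i \<in> ones x' \<Longrightarrow> \<bar>real i - real p\<bar> \<ge> 4 * \<delta>"
    | (isolated') p where "p \<in> ones x'" "\<And>i. i \<in> ones x \<Longrightarrow> \<bar>real i - real p\<bar> \<ge> 4 * \<delta>"
    | (aligned) "\<And>i. i \<in> ones x \<Longrightarrow> \<exists>j\<in>ones x'. \<bar>real j - real i\<bar> < 4 * \<delta>"
        "\<And>i. i \<in> ones x' \<Longrightarrow> \<exists>j\<in>ones x. \<bar>real j - real i\<bar> < 4 * \<delta>"
    by (meson not_le)
  thus ?thesis
  proof cases
    case isolated
    thus ?thesis by (intro distinguishable_sym[OF distinguishable_if_isolated[OF len(2,1)]])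
  next
    case isolated'
    thus ?thesis by (intro distinguishable_if_isolated[OF len])
  next
    case aligned
    have "ones x \<noteq> ones x'" using ne len ones_inject by auto
    then obtain p where "p \<in> ones x \<and> p \<notin> ones x' \<or> p \<in> ones x' \<and> p \<notin> ones x" by auto
    thus ?thesis
      using distinguishable_if_aligned[OF x len(2) aligned(2)]
        distinguishable_sym[OF distinguishable_if_aligned[OF x' len(1) aligned(1)]] by blast
  qed
qed

end

section \<open>Sparse random strings\<close>

text \<open>The decoder is chosen before \<eta>, as it is built from the chainless strings, whose
  definition does not involve \<eta>.\<close>

lemma sparse_reconstruction:
  fixes n :: nat
  assumes n: "n \<ge> 2"
  shows "\<exists>R. \<forall>\<eta>. 0 \<le> \<eta> \<and> \<eta> \<le> 1 \<and> \<eta> \<le> (1/384) / sqrt (real n * ln (real n)) \<longrightarrow>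
    measure_pmf.prob (source_and_traces (1/2) n \<eta> (n ^ 6)) {(x, ys). R ys = x}
      \<ge> 1 - 16 / real n ^ 3 - 2 * (2 ^ n)\<^sup>2 * exp (- (real n)\<^sup>2 / 32)"
proof -
  define r where "r = sqrt (real n * ln (real n))"
  \<comment> \<open>This makes \<open>2 * \<delta>\<^sup>2 / n = 8 * ln n\<close>, so drift has
    probability at most \<open>2 * (n + 1) / n ^ 8\<close>.\<close>
  define \<delta> where "\<delta> = 2 * r"
  define l where "l = nat \<lfloor>12 * \<delta>\<rfloor>"
  \<comment> \<open>The upper bound on \<open>2 ^ k\<close> keeps the survival probability of a
    cluster at least \<open>1 / n\<close>; the lower bound makes \<open>(1/16) ^ k\<close> at most
    \<open>16 / n ^ 4\<close>.\<close>
  obtain k where "2 ^ k \<le> n" "n < 2 ^ (k + 1)"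
    using ex_power_ivl1[of 2 n] n by auto
  hence "real (2 ^ k) \<le> real n" "real n \<le> real (2 ^ Suc k)" by (simp_all only: of_nat_le_iff) simp
  hence k: "2 ^ k \<le> real n" "real n \<le> 2 * 2 ^ k" by simp_all
  \<comment> \<open>The tests separate by \<open>1 / (2 * n\<^sup>2)\<close> up to drift; half of
    this is reserved for the drift.\<close>
  define \<epsilon> where "\<epsilon> = 1 / (4 * (real n)\<^sup>2)"
  let ?G = "chainless n l k"
  have r: "r > 0" using n by (simp add: r_def)
  hence \<delta>: "\<delta> > 0" by (simp add: \<delta>_def)
  have l: "12 * \<delta> < real l + 1" "real l \<le> 12 * \<delta>" using \<delta> unfolding l_def by linarith+
  have fin: "finite ?G" "card ?G \<le> 2 ^ n"
  proof -
    have sub: "?G \<subseteq> {xs. set xs \<subseteq> (UNIV :: bool set) \<and> length xs = n}" by (auto simp: chainless_def)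
    show "finite ?G" by (rule finite_subset[OF sub]) (rule finite_lists_length_eq, simp)
    show "card ?G \<le> 2 ^ n"
      using card_mono[OF finite_lists_length_eq sub] card_lists_length_eq[of "UNIV :: bool set" n] by simp
  qed
  have drift: "measure_pmf.prob (coins n) (drift n \<delta>) \<le> (n + 1) * 2 / real n ^ 8"
  proof -
    have "- 2 * \<delta>\<^sup>2 / n = - (8 * ln (real n))"
      using n by (simp add: \<delta>_def r_def power_mult_distrib)
    hence "exp (- 2 * \<delta>\<^sup>2 / n) = 1 / real n ^ 8"
      using n by (simp add: exp_minus exp_of_nat_mult[of 8, simplified] inverse_eq_divide)
    thus ?thesis using prob_drift_le[OF \<delta>, of n] by (simp add: add.commute)
  qed
  have gap: "\<epsilon> \<le> (1/2) ^ Suc k / n - 2 * measure_pmf.prob (coins n) (drift n \<delta>)"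
  proof -
    have "2 ^ 5 \<le> real n ^ 5" using n by (intro power_mono) auto
    hence "16 * (real n + 1) \<le> real n ^ 5 * real n"
    proof -
      assume *: "2 ^ 5 \<le> real n ^ 5"
      have "16 * (real n + 1) \<le> 2 ^ 5 * real n" using n by simp
      also have "\<dots> \<le> real n ^ 5 * real n" using * by (intro mult_right_mono) auto
      finally show ?thesis .
    qed
    hence "16 * (real n + 1) \<le> real n ^ 6" by (simp add: power_numeral_reduce mult_ac)
    hence "16 * (real n + 1) / (4 * real n ^ 8) \<le> real n ^ 6 / (4 * real n ^ 8)"
      by (intro divide_right_mono) auto
    also have "\<dots> = 1 / (4 * (real n)\<^sup>2)"
      using n by (simp add: field_simps flip: power_add)
    finally have "2 * ((n + 1) * 2 / real n ^ 8) \<le> 1 / (4 * (real n)\<^sup>2)"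
      by (simp add: algebra_simps add_divide_distrib)
    moreover have "1 / (2 * (real n)\<^sup>2) \<le> (1/2) ^ Suc k / n"
    proof -
      have "1 / (2 * real n) \<le> 1 / (2 * 2 ^ k)" using k n by (intro divide_left_mono mult_left_mono) auto
      hence "1 / (2 * real n) / n \<le> 1 / (2 * 2 ^ k) / n" by (intro divide_right_mono) auto
      thus ?thesis by (simp add: power2_eq_square power_one_over mult_ac)
    qed
    moreover have "\<epsilon> = 1 / (2 * (real n)\<^sup>2) - 1 / (4 * (real n)\<^sup>2)" by (simp add: \<epsilon>_def field_simps)
    ultimately show ?thesis using drift by linarith
  qed
  have "\<exists>R. \<forall>x\<in>?G. measure_pmf.prob (replicate_pmf (n ^ 6) (deletion_channel (1/2) x)) {ys. R ys \<noteq> x}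
           \<le> 2 * (card ?G)\<^sup>2 * exp (- real (n ^ 6) * \<epsilon>\<^sup>2 / 2)"
  proof (rule pairwise_tests_imp_reconstruction[OF fin(1)])
    show "\<epsilon> > 0" using n by (simp add: \<epsilon>_def)
    fix x y assume "x \<in> ?G" "y \<in> ?G" "x \<noteq> y"
    hence "distinguishable \<epsilon> x y"
      using distinguishable_antimono[OF chainless_distinguishable[OF \<delta> l(1)] gap] by blast
    thus "\<exists>f :: bool list \<Rightarrow> real. (\<forall>z. f z \<in> {0..1}) \<and>
        \<bar>measure_pmf.expectation (deletion_channel (1/2) x) f
          - measure_pmf.expectation (deletion_channel (1/2) y) f\<bar> \<ge> \<epsilon>"
      by (simp only: distinguishable_def)
  qed
  then obtain R where R: "\<And>x. x \<in> ?G \<Longrightarrow>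
      measure_pmf.prob (replicate_pmf (n ^ 6) (deletion_channel (1/2) x)) {ys. R ys \<noteq> x}
        \<le> 2 * (card ?G)\<^sup>2 * exp (- real (n ^ 6) * \<epsilon>\<^sup>2 / 2)" by blast
  have fail: "2 * (card ?G)\<^sup>2 * exp (- real (n ^ 6) * \<epsilon>\<^sup>2 / 2) \<le> 2 * (2 ^ n)\<^sup>2 * exp (- (real n)\<^sup>2 / 32)"
  proof -
    have "real (card ?G) \<le> real (2 ^ n)" using fin(2) by (simp only: of_nat_le_iff)
    hence "(real (card ?G))\<^sup>2 \<le> (2 ^ n)\<^sup>2" by (intro power_mono) auto
    \<comment> \<open>This fixes the number of traces: with \<open>n ^ 6\<close> of them the
      exponent is quadratic in \<open>n\<close> and beats the \<open>4 ^ n\<close> pairs.\<close>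
    moreover have "- real (n ^ 6) * \<epsilon>\<^sup>2 / 2 = - (real n)\<^sup>2 / 32"
      using n by (simp add: \<epsilon>_def field_simps power_numeral_reduce)
    ultimately show ?thesis by (simp only: of_nat_power) (intro mult_right_mono mult_left_mono; simp)
  qed
  show ?thesis
  proof (intro exI[of _ R] allI impI, elim conjE)
    fix \<eta> :: real assume \<eta>: "0 \<le> \<eta>" "\<eta> \<le> 1" "\<eta> \<le> (1/384) / sqrt (real n * ln (real n))"
    \<comment> \<open>Here \<open>12 * \<delta> = 24 * r\<close>, and
      \<open>384 = 24 * 16\<close>.\<close>
    have "\<eta> * l \<le> (1/384) / r * (12 * \<delta>)"
      using \<eta> l r unfolding r_def[symmetric] by (intro mult_mono) auto
    also have "\<dots> = 1/16" using r by (simp add: \<delta>_def)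
    finally have "n * (\<eta> * l) ^ k \<le> n * (1/16) ^ k"
      using \<eta> by (intro mult_left_mono power_mono) auto
    also have "\<dots> = n / (2 ^ k) ^ 4"
    proof -
      have "((2 :: real) ^ k) ^ 4 = (2 ^ 4) ^ k" by (simp only: power_mult[symmetric] mult.commute)
      thus ?thesis by (simp add: power_one_over)
    qed
    also have "\<dots> \<le> n / (real n / 2) ^ 4"
      using k n by (intro divide_left_mono power_mono) auto
    also have "\<dots> = 16 / real n ^ 3" using n by (simp add: field_simps power_numeral_reduce)
    finally have "measure_pmf.prob (random_string n \<eta>) (- ?G) \<le> 16 / real n ^ 3"
      using prob_not_chainless_le[OF \<eta>(1,2), of n l k] by linarith
    moreover have "1 - measure_pmf.prob (random_string n \<eta>) (- ?G) - 2 * (2 ^ n)\<^sup>2 * exp (- (real n)\<^sup>2 / 32)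
        \<le> measure_pmf.prob (source_and_traces (1/2) n \<eta> (n ^ 6)) {(x, ys). R ys = x}"
      by (rule prob_source_and_traces_ge) (simp, rule order_trans[OF R fail])
    ultimately show "measure_pmf.prob (source_and_traces (1/2) n \<eta> (n ^ 6)) {(x, ys). R ys = x}
      \<ge> 1 - 16 / real n ^ 3 - 2 * (2 ^ n)\<^sup>2 * exp (- (real n)\<^sup>2 / 32)" by linarith
  qed
qed

theorem theorem10:
  shows "\<exists>c::real. c > 0 \<and>
    (\<exists>(T :: nat \<Rightarrow> nat) (d :: nat) (reconstruct :: nat \<Rightarrow> bool list list \<Rightarrow> bool list).
      (\<lambda>n. real (T n)) \<in> O(\<lambda>n. real n ^ d) \<and>
      (\<forall>\<eta> :: nat \<Rightarrow> real.
        (\<forall>n. 0 \<le> \<eta> n \<and> \<eta> n \<le> 1) \<and>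
        (\<forall>n\<ge>2. \<eta> n \<le> c / sqrt (real n * ln (real n))) \<longrightarrow>
        (\<lambda>n. measure_pmf.prob (source_and_traces (1/2) n (\<eta> n) (T n))
               {(x, ys). reconstruct n ys = x}) \<longlonglongrightarrow> 1))"
proof -
  let ?lower = "\<lambda>n. 1 - 16 / real n ^ 3 - 2 * (2 ^ n)\<^sup>2 * exp (- (real n)\<^sup>2 / 32)"
  have "\<forall>n. \<exists>R. n \<ge> 2 \<longrightarrow> (\<forall>\<eta>. 0 \<le> \<eta> \<and> \<eta> \<le> 1 \<and> \<eta> \<le> (1/384) / sqrt (real n * ln (real n)) \<longrightarrow>
      measure_pmf.prob (source_and_traces (1/2) n \<eta> (n ^ 6)) {(x, ys). R ys = x} \<ge> ?lower n)"
    using sparse_reconstruction by blast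
  then obtain reconstruct where rec: "\<And>n \<eta>. n \<ge> 2 \<Longrightarrow> 0 \<le> \<eta> \<Longrightarrow> \<eta> \<le> 1 \<Longrightarrow>
      \<eta> \<le> (1/384) / sqrt (real n * ln (real n)) \<Longrightarrow>
      measure_pmf.prob (source_and_traces (1/2) n \<eta> (n ^ 6)) {(x, ys). reconstruct n ys = x} \<ge> ?lower n"
    by metis
  \<comment> \<open>The Gaussian factor dominates \<open>(2 ^ n)\<^sup>2\<close>.\<close>
  have lower: "?lower \<longlonglongrightarrow> 1" by real_asymp
  show ?thesis
  proof (intro exI[of _ "1/384 :: real"] conjI exI[of _ "\<lambda>n. n ^ 6"] exI[of _ "6 :: nat"]
      exI[of _ reconstruct] allI impI)
    fix \<eta> :: "nat \<Rightarrow> real"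
    assume \<eta>: "(\<forall>n. 0 \<le> \<eta> n \<and> \<eta> n \<le> 1) \<and> (\<forall>n\<ge>2. \<eta> n \<le> (1/384) / sqrt (real n * ln (real n)))"
    show "(\<lambda>n. measure_pmf.prob (source_and_traces (1/2) n (\<eta> n) (n ^ 6))
               {(x, ys). reconstruct n ys = x}) \<longlonglongrightarrow> 1"
    proof (rule tendsto_sandwich[OF _ _ lower tendsto_const])
      show "\<forall>\<^sub>F n in sequentially. ?lower n
          \<le> measure_pmf.prob (source_and_traces (1/2) n (\<eta> n) (n ^ 6)) {(x, ys). reconstruct n ys = x}"
        using eventually_ge_at_top[of 2] by eventually_elim (use rec \<eta> in auto)
    qed (simp add: measure_pmf.prob_le_1)
  qed simp_all
qed

end
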